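(* Let $r\ge2$ be an integer and assume $p=1/r$. Then, with probability one, $$\frac{\log_r R_d}{d}\longrightarrow 1,\qquad d\to\infty.$$ Moreover, for any $x\in\mathbb{R}$, $$\mathbb{P}\left(\log_r R_d\le d+x\right)\longrightarrow\exp\left(-C\,r^{-x}\right),\qquad d\to\infty,\qquad \text{where } C:=\frac{2rp}{r-1}.$$
   Context: Let $\mathbb{T}$ be the infinite $r$-ary tree rooted at $\rho_0$ (every node has exactly $r$ children). To each node $v\in\mathbb{T}$ is attached a random variable $X_v$, where the family $\{X_v:v\in\mathbb{T}\}$ is i.i.d. Bernoulli with $\mathbb{P}(X_v=1)=1-\mathbb{P}(X_v=0)=p\in(0,1)$. A subset $A\subset\mathbb{T}$ is open if $X_v=1$ for all $v\in A$. The generation $\mathrm{gen}(v)$ is the graph distance from $\rho_0$ to $v$ (so $\mathrm{gen}(\rho_0)=0$), and $\mathbb{T}_d=\{v\in\mathbb{T}:\mathrm{gen}(v)\le d\}$. A run is a (nonempty) path in $\mathbb{T}$ directed away from the root $\rho_0$, i.e. a set of nodes in which each node after the first is a child of the previous one; its length $|A|$ is its number of nodes and its root $\rho(A)$ is its node of minimal generation. For $d\in\mathbb{N}$, $R_d$ is the length of the longest open run whose root has generation at most $d$: $$R_d=\max\{|A|: A\text{ an open run with }\rho(A)\in\mathbb{T}_d\},$$ with the convention that the maximum is $0$ if there is no such run, that it is read as a supremum in $[0,\infty]$, and that $\log_r0=-\infty$. $\log_r$ denotes the logarithm in base $r$. *)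

theory Defs
  imports "HOL-Probability.Probability"
begin

text \<open>
  Nodes of the infinite \<open>r\<close>-ary tree are finite words over \<open>{0, ..., r - 1}\<close>: the root is the
  empty word and the children of \<open>v\<close> are the words \<open>v @ [i]\<close> with \<open>i < r\<close>. Hence the graph
  distance from \<open>v\<close> to the root is the length of the word.
\<close>

type_synonym node = "nat list"

definition tree :: "nat \<Rightarrow> node set" where
  "tree r = lists {..<r}"

definition child :: "nat \<Rightarrow> node \<Rightarrow> node \<Rightarrow> bool" where
  "child r v w \<longleftrightarrow> (\<exists>i<r. w = v @ [i])"

definition gen :: "node \<Rightarrow> nat" where
  "gen v = length v"

definition tree_upto :: "nat \<Rightarrow> nat \<Rightarrow> node set" where
  "tree_upto r d = {v \<in> tree r. gen v \<le> d}"

text \<open>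
  A run is the set of nodes of a downward path with \<open>n\<close> nodes, \<open>0 < n \<le> \<infinity>\<close>. Infinite paths
  (rays) are included; since their finite initial segments are runs too, they do not affect
  the supremum below.
\<close>

definition is_run :: "nat \<Rightarrow> node set \<Rightarrow> bool" where
  "is_run r A \<longleftrightarrow>
     (\<exists>(n::enat) (v::nat \<Rightarrow> node). 0 < n \<and> A = v ` {i. enat i < n} \<and> A \<subseteq> tree r \<and>
        (\<forall>i. enat (Suc i) < n \<longrightarrow> child r (v i) (v (Suc i))))"

definition run_length :: "node set \<Rightarrow> enat" where
  "run_length A = (if finite A then enat (card A) else \<infinity>)"

definition run_root :: "node set \<Rightarrow> node" where
  "run_root A = arg_min_on gen A"

definition is_open :: "(node \<Rightarrow> 'a \<Rightarrow> real) \<Rightarrow> 'a \<Rightarrow> node set \<Rightarrow> bool" where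
  "is_open X \<omega> A \<longleftrightarrow> (\<forall>v\<in>A. X v \<omega> = 1)"

text \<open>The supremum of the empty set is \<open>0\<close> in \<^typ>\<open>enat\<close>.\<close>

definition longest_run :: "nat \<Rightarrow> (node \<Rightarrow> 'a \<Rightarrow> real) \<Rightarrow> nat \<Rightarrow> 'a \<Rightarrow> enat" where
  "longest_run r X d \<omega> =
     Sup {run_length A |A. is_run r A \<and> is_open X \<omega> A \<and> run_root A \<in> tree_upto r d}"

definition elog :: "real \<Rightarrow> enat \<Rightarrow> ereal" where
  "elog b n =
     (case n of enat k \<Rightarrow> (if k = 0 then -\<infinity> else ereal (log b (real k))) | \<infinity> \<Rightarrow> \<infinity>)"

end

theory Submission
  imports Defs
begin

text \<open>
  The probability \<open>q\<^sub>n\<close> that an open run of length \<open>n\<close> starts at a given node satisfies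
  \<open>q\<^sub>0 = 1\<close> and \<open>r q\<^sub>n\<^sub>+\<^sub>1 = 1 - (1 - q\<^sub>n)\<^sup>r\<close>. The increments of \<open>1 / q\<^sub>n\<close> converge to
  \<open>(r - 1) / 2\<close>, so \<open>n q\<^sub>n\<close> tends to \<open>2 / (r - 1)\<close>. A run of length \<open>n \<ge> d\<close> with root in
  generation at most \<open>d\<close> contains at least \<open>n - d\<close> nodes from generation \<open>d\<close> onwards; hence
  the event \<open>R\<^sub>d < n\<close> lies between the events that none of the \<open>r\<^sup>d\<close> nodes of generation \<open>d\<close>
  starts an open run of length \<open>n - d\<close>, respectively \<open>n\<close>. These nodes have disjoint sets of
  descendants, so the two events have probabilities \<open>(1 - q\<^sub>n\<^sub>-\<^sub>d)\<close> and \<open>(1 - q\<^sub>n)\<close> raised to the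
  power \<open>r\<^sup>d\<close>. For \<open>n\<close> of order \<open>r\<^sup>d\<^sup>+\<^sup>x\<close> the shift by \<open>d\<close> is negligible and both bounds have
  the asserted limit. The same bounds at \<open>n\<close> of order \<open>r\<close> to the power \<open>(1 \<plusminus> \<epsilon>) d\<close> are
  geometrically small, and the Borel-Cantelli lemma gives the almost sure statement.
\<close>

subsection \<open>Two limits of real sequences\<close>

text \<open>Stolz-Cesaro argument: once the increments are within \<open>e / 2\<close> of
  \<open>c\<close>, the deviation of \<open>u n\<close> from \<open>c * n\<close> grows by at most
  \<open>e / 2\<close> per step, and division by \<open>n\<close> makes the initial deviation
  \<open>K\<close> negligible.\<close>

lemma tendsto_divide_index_of_increments:
  fixes u :: "nat \<Rightarrow> real"
  assumes "(\<lambda>n. u (Suc n) - u n) \<longlonglongrightarrow> c"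
  shows "(\<lambda>n. u n / real n) \<longlonglongrightarrow> c"
proof (rule LIMSEQ_I)
  fix e :: real assume "0 < e"
  then obtain N where N: "\<And>n. n \<ge> N \<Longrightarrow> \<bar>u (Suc n) - u n - c\<bar> < e / 2"
    using LIMSEQ_D[OF assms, of "e/2"] by auto
  define K where "K = \<bar>u N - c * real N\<bar>"
  have bound: "\<bar>u n - c * real n\<bar> \<le> K + e / 2 * real (n - N)" if "n \<ge> N" for n
    using that
  proof (induction n rule: dec_induct)
    case base
    then show ?case by (simp add: K_def)
  next
    case (step n)
    have "\<bar>u (Suc n) - c * real (Suc n)\<bar> \<le> \<bar>u n - c * real n\<bar> + \<bar>u (Suc n) - u n - c\<bar>"
      by (simp add: algebra_simps)
    also have "\<dots> \<le> K + e / 2 * real (n - N) + e / 2"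
      using N[of n] step by simp
    also have "\<dots> = K + e / 2 * real (Suc n - N)"
      using step by (simp add: Suc_diff_le field_simps)
    finally show ?case .
  qed
  obtain m where "max 0 (2 * K / e) < real m"
    using reals_Archimedean2 by blast
  then have m: "2 * K / e < real m" "m > 0" by auto
  show "\<exists>n0. \<forall>n\<ge>n0. norm (u n / real n - c) < e"
  proof (intro exI allI impI)
    fix n assume n: "n \<ge> max N m"
    have pos: "real n > 0" using n m by simp
    have "\<bar>u n - c * real n\<bar> \<le> K + e / 2 * real n"
      using bound[of n] n \<open>0 < e\<close>
      by (smt (verit) max.bounded_iff mult_left_mono of_nat_mono diff_le_self half_gt_zero)
    also have "K < e / 2 * real n"
    proof -
      have "2 * K / e < real n" using m n by simp
      then show ?thesis using \<open>0 < e\<close> by (simp add: field_simps)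
    qed
    finally have "\<bar>u n - c * real n\<bar> < e * real n" by simp
    moreover have "u n / real n - c = (u n - c * real n) / real n"
      using pos by (simp add: field_simps)
    ultimately show "norm (u n / real n - c) < e"
      using pos by (simp add: divide_less_eq)
  qed
qed

text \<open>For \<open>q < 1/2\<close> the logarithm of \<open>1 - q\<close> lies between
  \<open>- q - 2 q^2\<close> and \<open>- q\<close>. Multiplied by \<open>N\<close>, the quadratic
  error is \<open>2 (N q) q\<close>, which tends to 0.\<close>

lemma tendsto_one_minus_power_exp:
  fixes q :: "nat \<Rightarrow> real" and N :: "nat \<Rightarrow> nat"
  assumes q: "\<And>n. 0 \<le> q n" "q \<longlonglongrightarrow> 0" and lim: "(\<lambda>n. real (N n) * q n) \<longlonglongrightarrow> l"
  shows "(\<lambda>n. (1 - q n) ^ N n) \<longlonglongrightarrow> exp (- l)"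
proof -
  have small: "\<forall>\<^sub>F n in sequentially. q n < 1 / 2"
    using order_tendstoD(2)[OF q(2), of "1/2"] by simp
  have "(\<lambda>n. real (N n) * ln (1 - q n)) \<longlonglongrightarrow> - l"
  proof (rule tendsto_sandwich)
    show "\<forall>\<^sub>F n in sequentially.
        - (real (N n) * q n) - 2 * (real (N n) * q n) * q n \<le> real (N n) * ln (1 - q n)"
      using small
    proof eventually_elim
      case (elim n)
      then have "- q n - 2 * (q n)\<^sup>2 \<le> ln (1 - q n)"
        using ln_one_minus_pos_lower_bound[of "q n"] q(1)[of n] by simp
      from mult_left_mono[OF this, of "real (N n)"] show ?case
        by (simp add: algebra_simps power2_eq_square)
    qed
    show "\<forall>\<^sub>F n in sequentially. real (N n) * ln (1 - q n) \<le> - (real (N n) * q n)"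
      using small
    proof eventually_elim
      case (elim n)
      then have "ln (1 - q n) \<le> - q n"
        using ln_add_one_self_le_self2[of "- q n"] by simp
      from mult_left_mono[OF this, of "real (N n)"] show ?case by simp
    qed
    have "(\<lambda>n. - (real (N n) * q n) - 2 * (real (N n) * q n) * q n) \<longlonglongrightarrow> - l - 2 * l * 0"
      by (intro tendsto_intros lim q)
    then show "(\<lambda>n. - (real (N n) * q n) - 2 * (real (N n) * q n) * q n) \<longlonglongrightarrow> - l" by simp
    show "(\<lambda>n. - (real (N n) * q n)) \<longlonglongrightarrow> - l" by (intro tendsto_intros lim)
  qed
  then have "(\<lambda>n. exp (real (N n) * ln (1 - q n))) \<longlonglongrightarrow> exp (- l)"
    by (intro tendsto_intros)
  moreover have "\<forall>\<^sub>F n in sequentially. exp (real (N n) * ln (1 - q n)) = (1 - q n) ^ N n"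
    using small by eventually_elim (simp add: exp_of_nat_mult)
  ultimately show ?thesis by (rule Lim_transform_eventually)
qed

subsection \<open>Survival probabilities of the critical branching process\<close>

text \<open>First-generation decomposition: \<open>1 / r\<close> is the chance that a node is open,
  the other factor the chance that one of \<open>r\<close> independent child subtrees carries a run
  of length \<open>n\<close>.\<close>

fun survival :: "nat \<Rightarrow> nat \<Rightarrow> real" where
  "survival r 0 = 1"
| "survival r (Suc n) = (1 - (1 - survival r n) ^ r) / real r"

lemma survival_pos_le_one:
  assumes "r \<ge> 1"
  shows "0 < survival r n \<and> survival r n \<le> 1"
proof (induction n)
  case (Suc n)
  then have "0 \<le> (1 - survival r n) ^ r" "(1 - survival r n) ^ r < 1"
    using assms by (auto intro!: power_less_one_iff[THEN iffD2])
  moreover have "1 - (1 - survival r n) ^ r \<le> real r"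
    using calculation assms by linarith
  ultimately show ?case using assms by simp
qed simp

lemmas survival_pos = survival_pos_le_one[THEN conjunct1]
lemmas survival_le_one = survival_pos_le_one[THEN conjunct2]

text \<open>The divided difference \<open>(1 - (1 - q)^r) / q\<close> and, next,
  \<open>(r - geo_sum r q) / q\<close>, written as polynomials so that they are continuous at
  \<open>q = 0\<close>.\<close>

definition geo_sum :: "nat \<Rightarrow> real \<Rightarrow> real" where
  "geo_sum r q = (\<Sum>k<r. (1 - q) ^ k)"

definition double_geo_sum :: "nat \<Rightarrow> real \<Rightarrow> real" where
  "double_geo_sum r q = (\<Sum>k<r. geo_sum k q)"

lemma geo_sum_mult: "q * geo_sum r q = 1 - (1 - q) ^ r"
  unfolding geo_sum_def using one_diff_power_eq[of "1 - q" r] by simp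

lemma double_geo_sum_mult: "q * double_geo_sum r q = real r - geo_sum r q"
  unfolding double_geo_sum_def sum_distrib_left geo_sum_mult
  by (simp add: sum_subtractf geo_sum_def)

lemma geo_sum_bounds:
  assumes "0 \<le> q" "q \<le> 1" "r \<ge> 1"
  shows "1 \<le> geo_sum r q" "geo_sum r q \<le> real r"
proof -
  show "geo_sum r q \<le> real r"
    unfolding geo_sum_def using sum_bounded_above[of "{..<r}" "\<lambda>k. (1 - q) ^ k" 1] assms
    by (simp add: power_le_one)
  have "(1 - q) ^ 0 \<le> geo_sum r q"
    unfolding geo_sum_def by (rule member_le_sum) (use assms in auto)
  then show "1 \<le> geo_sum r q" by simp
qed

lemma double_geo_sum_bounds:
  assumes "0 \<le> q" "q \<le> 1" "r \<ge> 2"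
  shows "1 \<le> double_geo_sum r q" "double_geo_sum r q \<le> real r * real r"
proof -
  have nonneg: "0 \<le> geo_sum k q" for k
    unfolding geo_sum_def using assms by (auto intro!: sum_nonneg)
  \<comment> \<open>The summand for \<open>k = 0\<close> is an empty sum; the one for
    \<open>k = 1\<close> equals 1 and occurs because \<open>r \<ge> 2\<close>.\<close>
  have "geo_sum 1 q \<le> double_geo_sum r q"
    unfolding double_geo_sum_def by (rule member_le_sum) (use assms nonneg in auto)
  then show "1 \<le> double_geo_sum r q" by (simp add: geo_sum_def)
  have le: "geo_sum k q \<le> real r" if "k < r" for k
    using that geo_sum_bounds(2)[OF assms(1,2), of k]
    by (cases "k = 0") (auto simp: geo_sum_def)
  show "double_geo_sum r q \<le> real r * real r"
    unfolding double_geo_sum_def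
    using sum_bounded_above[of "{..<r}" "\<lambda>k. geo_sum k q" "real r"] le by simp
qed

text \<open>With \<open>q = survival r n\<close>, the next reciprocal is
  \<open>r / (q * geo_sum r q)\<close>. Subtracting \<open>1 / q\<close> leaves the numerator
  \<open>r - geo_sum r q\<close>, whose factor \<open>q\<close> cancels.\<close>

lemma inverse_survival_increment:
  assumes "r \<ge> 2"
  shows "1 / survival r (Suc n) - 1 / survival r n
    = double_geo_sum r (survival r n) / geo_sum r (survival r n)"
proof -
  let ?q = "survival r n"
  have q: "0 < ?q" "?q \<le> 1" using survival_pos survival_le_one assms by auto
  have S: "geo_sum r ?q \<ge> 1" using geo_sum_bounds[of ?q r] q assms by simp
  have "1 / survival r (Suc n) - 1 / ?q = (real r - geo_sum r ?q) / (?q * geo_sum r ?q)"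
    unfolding survival.simps geo_sum_mult[symmetric] using q S assms by (simp add: field_simps)
  then show ?thesis
    unfolding double_geo_sum_mult[symmetric] using q by simp
qed

text \<open>Crude but uniform in \<open>n\<close>. Telescoped, these bounds give explicit estimates
  of order \<open>1 / n\<close> for \<open>survival\<close>, which the Borel-Cantelli arguments
  use.\<close>

lemma inverse_survival_increment_bounds:
  assumes "r \<ge> 2"
  shows "1 / real r \<le> 1 / survival r (Suc n) - 1 / survival r n"
    and "1 / survival r (Suc n) - 1 / survival r n \<le> real r * real r"
proof -
  let ?q = "survival r n"
  have q: "0 \<le> ?q" "?q \<le> 1" using survival_pos_le_one[of r n] assms by auto
  note S = geo_sum_bounds[OF q, of r] and T = double_geo_sum_bounds[OF q assms]
  show "1 / real r \<le> 1 / survival r (Suc n) - 1 / survival r n"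
    unfolding inverse_survival_increment[OF assms]
    by (rule frac_le) (use S T assms in auto)
  have "double_geo_sum r ?q / geo_sum r ?q \<le> real r * real r / 1"
    by (rule frac_le) (use S T assms in auto)
  then show "1 / survival r (Suc n) - 1 / survival r n \<le> real r * real r"
    unfolding inverse_survival_increment[OF assms] by simp
qed

lemma survival_upper_bound:
  assumes "r \<ge> 2" "n \<ge> 1"
  shows "survival r n \<le> real r / real n"
proof -
  have "real n / real r \<le> 1 / survival r n" for n
  proof (induction n)
    case (Suc n)
    then show ?case
      using inverse_survival_increment_bounds(1)[OF assms(1), of n] by (simp add: add_divide_distrib)
  qed simp
  from this[of n] show ?thesis
    using survival_pos[of r n] assms by (simp add: field_simps)
qed

lemma survival_lower_bound:
  assumes "r \<ge> 2" "n \<ge> 1"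
  shows "1 / ((1 + real r * real r) * real n) \<le> survival r n"
proof -
  have "1 / survival r n \<le> 1 + real r * real r * real n" for n
  proof (induction n)
    case (Suc n)
    then show ?case
      using inverse_survival_increment_bounds(2)[OF assms(1), of n] by (simp add: algebra_simps)
  qed simp
  \<comment> \<open>The starting value \<open>1 / survival r 0 = 1\<close> is absorbed by
    \<open>n \<ge> 1\<close>.\<close>
  also have "1 + real r * real r * real n \<le> (1 + real r * real r) * real n"
    using assms by (simp add: algebra_simps)
  finally show ?thesis
    using le_imp_inverse_le[of "1 / survival r n"] survival_pos[of r n] assms
    by (simp add: inverse_eq_divide)
qed

lemma survival_tendsto_0:
  assumes "r \<ge> 2"
  shows "survival r \<longlonglongrightarrow> 0"
proof (rule tendsto_sandwich[OF _ _ tendsto_const])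
  show "\<forall>\<^sub>F n in sequentially. 0 \<le> survival r n"
    using survival_pos[of r] assms by (intro always_eventually allI less_imp_le) auto
  show "\<forall>\<^sub>F n in sequentially. survival r n \<le> real r / real n"
    using eventually_ge_at_top[of 1] by eventually_elim (rule survival_upper_bound[OF assms])
  show "(\<lambda>n. real r / real n) \<longlonglongrightarrow> 0"
    by (rule lim_const_over_n)
qed

text \<open>The increments of the reciprocals tend to the value of the quotient at 0, which is
  \<open>(r (r - 1) / 2) / r\<close>. Averaging yields the limit of
  \<open>1 / (n * survival r n)\<close>, which is then inverted.\<close>

lemma survival_asymptotics:
  assumes "r \<ge> 2"
  shows "(\<lambda>n. real n * survival r n) \<longlonglongrightarrow> 2 / (real r - 1)"
proof -
  have cont: "isCont (\<lambda>q. double_geo_sum r q / geo_sum r q) 0"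
    unfolding double_geo_sum_def geo_sum_def using assms by (auto intro!: continuous_intros)
  have at_0: "double_geo_sum r 0 / geo_sum r 0 = (real r - 1) / 2"
  proof -
    have "2 * (\<Sum>k<m. real k) = real m * (real m - 1)" for m :: nat
      by (induction m) (auto simp: algebra_simps)
    from this[of r] show ?thesis
      using assms unfolding double_geo_sum_def geo_sum_def by (simp add: field_simps)
  qed
  have "(\<lambda>n. 1 / survival r (Suc n) - 1 / survival r n) \<longlonglongrightarrow> (real r - 1) / 2"
    unfolding inverse_survival_increment[OF assms]
    using isCont_tendsto_compose[OF cont survival_tendsto_0[OF assms]] at_0 by simp
  from tendsto_inverse[OF tendsto_divide_index_of_increments[OF this]] assms
  show ?thesis by (simp add: field_simps)
qed

subsection \<open>Runs in the tree\<close>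

text \<open>Recursive form of the existence of an open run of \<open>n\<close> nodes from
  \<open>v\<close>. It parallels \<open>survival\<close> and carries the inductions for
  measurability and independence; for \<open>n = 0\<close> nothing is asked of
  \<open>v\<close>.\<close>

fun reaches :: "nat \<Rightarrow> (node \<Rightarrow> real) \<Rightarrow> nat \<Rightarrow> node \<Rightarrow> bool" where
  "reaches r f 0 v \<longleftrightarrow> True"
| "reaches r f (Suc n) v \<longleftrightarrow> f v = 1 \<and> (\<exists>i<r. reaches r f n (v @ [i]))"

lemma reaches_SucD: "reaches r f (Suc n) v \<Longrightarrow> reaches r f n v"
proof (induction n arbitrary: v)
  case (Suc n)
  then show ?case unfolding reaches.simps(2)[of r f "Suc n"] reaches.simps(2)[of r f n v] by blast
qed simp

lemma reaches_antimono: "m \<le> n \<Longrightarrow> reaches r f n v \<Longrightarrow> reaches r f m v"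
  by (induction n rule: dec_induct) (auto dest: reaches_SucD simp del: reaches.simps)

lemma append_in_tree_iff: "v @ [i] \<in> tree r \<longleftrightarrow> v \<in> tree r \<and> i < r"
  by (auto simp: tree_def)

text \<open>Each step along the run uses up one node. This lets a run be followed down to a
  prescribed generation.\<close>

lemma reaches_descendant:
  assumes "reaches r f n v" "v \<in> tree r" "k \<le> n"
  shows "\<exists>w\<in>tree r. length w = length v + k \<and> reaches r f (n - k) w"
  using \<open>k \<le> n\<close>
proof (induction k)
  case 0
  then show ?case using assms by auto
next
  case (Suc k)
  then obtain w where w: "w \<in> tree r" "length w = length v + k" "reaches r f (n - k) w"
    by auto
  then obtain i where "i < r" "reaches r f (n - Suc k) (w @ [i])"
    using Suc.prems by (cases "n - k") (auto simp: diff_Suc split: nat.splits)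
  then show ?case
    using w by (intro bexI[of _ "w @ [i]"]) (auto simp: append_in_tree_iff)
qed

lemma reaches_path:
  assumes "r \<ge> 1"
  shows "reaches r f n v \<longleftrightarrow> (\<exists>w. w 0 = v \<and> (\<forall>i<n. f (w i) = 1) \<and>
           (\<forall>i. Suc i < n \<longrightarrow> child r (w i) (w (Suc i))))"
proof (induction n arbitrary: v)
  case (Suc n)
  show ?case
  proof
    assume "reaches r f (Suc n) v"
    then obtain i w where "i < r" "f v = 1" and w: "w 0 = v @ [i]" "\<forall>i<n. f (w i) = 1"
      "\<forall>i. Suc i < n \<longrightarrow> child r (w i) (w (Suc i))"
      using Suc.IH by auto
    then have "child r v (w 0)" by (auto simp: child_def)
    with w \<open>f v = 1\<close> show "\<exists>w. w 0 = v \<and> (\<forall>i<Suc n. f (w i) = 1) \<and>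
        (\<forall>i. Suc i < Suc n \<longrightarrow> child r (w i) (w (Suc i)))"
      by (intro exI[of _ "case_nat v w"]) (auto split: nat.splits)
  next
    assume "\<exists>w. w 0 = v \<and> (\<forall>i<Suc n. f (w i) = 1) \<and>
        (\<forall>i. Suc i < Suc n \<longrightarrow> child r (w i) (w (Suc i)))"
    then obtain w where w: "w 0 = v" "\<And>i. i < Suc n \<Longrightarrow> f (w i) = 1"
      "\<And>i. i < n \<Longrightarrow> child r (w i) (w (Suc i))"
      by auto
    have "\<exists>i<r. reaches r f n (v @ [i])"
    proof (cases n)
      \<comment> \<open>The recursion asks for a child even after a run of one node; child 0 exists
        since \<open>r \<ge> 1\<close>.\<close>
      case 0
      then show ?thesis using assms by (auto intro: exI[of _ 0])
    next
      case (Suc m)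
      with w(3)[of 0] w(1) obtain i where i: "i < r" "w (Suc 0) = v @ [i]"
        by (auto simp: child_def)
      have "reaches r f n (v @ [i])"
        unfolding Suc.IH by (rule exI[of _ "\<lambda>j. w (Suc j)"]) (use w i in auto)
      then show ?thesis using i by auto
    qed
    then show "reaches r f (Suc n) v" using w by auto
  qed
qed auto

lemma child_path_length:
  assumes "\<And>i. enat (Suc i) < n \<Longrightarrow> child r (w i) (w (Suc i))" "enat i < n"
  shows "length (w i) = length (w 0) + i"
  using assms(2)
proof (induction i)
  case (Suc i)
  then have "enat i < n" by (metis Suc_ile_eq order_less_imp_le)
  with Suc assms(1)[of i] show ?case by (auto simp: child_def)
qed simp

lemma child_path_tree:
  assumes "\<And>i. enat (Suc i) < n \<Longrightarrow> child r (w i) (w (Suc i))" "w 0 \<in> tree r" "enat i < n"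
  shows "w i \<in> tree r"
  using assms(3)
proof (induction i)
  case (Suc i)
  then have "enat i < n" by (metis Suc_ile_eq order_less_imp_le)
  with Suc assms(1)[of i] show ?case by (auto simp: child_def append_in_tree_iff)
qed (use assms in simp)

text \<open>The \<open>i\<close>-th node lies \<open>i\<close> generations below \<open>w 0\<close>.
  So the nodes are distinct and \<open>w 0\<close> is the only minimiser of \<open>gen\<close>,
  which pins down the choice made by \<open>arg_min_on\<close>.\<close>

lemma child_path_run:
  assumes "\<And>i. enat (Suc i) < n \<Longrightarrow> child r (w i) (w (Suc i))" "0 < n"
  shows "run_root (w ` {i. enat i < n}) = w 0" "run_length (w ` {i. enat i < n}) = n"
proof -
  have len: "length (w i) = length (w 0) + i" if "enat i < n" for i
    using child_path_length[of n r w i] assms(1) that by blast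
  have "is_arg_min gen (\<lambda>x. x \<in> w ` {i. enat i < n}) x \<longleftrightarrow> x = w 0" for x
  proof
    assume x: "is_arg_min gen (\<lambda>x. x \<in> w ` {i. enat i < n}) x"
    then obtain i where i: "x = w i" "enat i < n" by (auto simp: is_arg_min_def)
    have "\<not> gen (w 0) < gen x"
      using x assms(2) by (auto simp: is_arg_min_def zero_enat_def)
    with i len[of i] show "x = w 0" by (auto simp: gen_def)
  next
    assume "x = w 0"
    moreover have "\<not> length (w i) < length (w 0)" if "enat i < n" for i
      using len[OF that] by linarith
    ultimately show "is_arg_min gen (\<lambda>x. x \<in> w ` {i. enat i < n}) x"
      using assms(2) by (auto simp: is_arg_min_def zero_enat_def gen_def)
  qed
  then show "run_root (w ` {i. enat i < n}) = w 0"
    unfolding run_root_def arg_min_on_def arg_min_def by (intro some_equality) auto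
  have inj: "inj_on w {i. enat i < n}"
    by (rule inj_onI) (metis len mem_Collect_eq add_left_cancel)
  show "run_length (w ` {i. enat i < n}) = n"
  proof (cases n)
    case (enat m)
    then have "{i. enat i < n} = {..<m}" by auto
    with inj enat show ?thesis by (simp add: run_length_def card_image)
  next
    case infinity
    with inj have "infinite (w ` {i. enat i < n})" by (simp add: finite_image_iff)
    with infinity show ?thesis by (simp add: run_length_def)
  qed
qed

text \<open>Members below \<open>n\<close> are at most \<open>n - 1\<close>, hence so is their
  supremum. A finite positive level is thus reached by a member even if the supremum is not
  attained.\<close>

lemma le_Sup_enat_iff:
  assumes "n > 0"
  shows "enat n \<le> Sup S \<longleftrightarrow> (\<exists>x\<in>S. enat n \<le> x)"
proof
  assume *: "enat n \<le> Sup S"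
  show "\<exists>x\<in>S. enat n \<le> x"
  proof (rule ccontr)
    assume "\<not> ?thesis"
    then have "x \<le> enat (n - 1)" if "x \<in> S" for x
      using that assms by (cases x) (auto simp: not_le)
    then have "Sup S \<le> enat (n - 1)" by (rule Sup_least)
    with * have "enat n \<le> enat (n - 1)" by (rule order_trans)
    with assms show False by simp
  qed
qed (auto intro: Sup_upper2)

text \<open>Trades the supremum over sets of nodes for a recursive condition at finitely many
  starting nodes, whose probability can be computed.\<close>

lemma longest_run_ge_iff:
  assumes "r \<ge> 1" "n > 0"
  shows "enat n \<le> longest_run r X d \<omega> \<longleftrightarrow> (\<exists>v\<in>tree_upto r d. reaches r (\<lambda>v. X v \<omega>) n v)"
proof
  assume "enat n \<le> longest_run r X d \<omega>"
  then obtain A where A: "is_run r A" "is_open X \<omega> A" "run_root A \<in> tree_upto r d"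
    "enat n \<le> run_length A"
    unfolding longest_run_def le_Sup_enat_iff[OF assms(2)] by auto
  then obtain N w where N: "0 < N" "A = w ` {i. enat i < N}"
    and w: "\<And>i. enat (Suc i) < N \<Longrightarrow> child r (w i) (w (Suc i))"
    unfolding is_run_def by auto
  have run: "run_root A = w 0" "run_length A = N"
    using child_path_run[of N r w] w N by blast+
  have "reaches r (\<lambda>v. X v \<omega>) n (w 0)"
    unfolding reaches_path[OF assms(1)]
  proof (intro exI[of _ w] conjI allI impI refl)
    \<comment> \<open>The run, possibly infinite, is cut after its first \<open>n\<close>
      nodes.\<close>
    have less: "enat i < N" if "i < n" for i
      using that A(4) run(2) by (metis enat_ord_simps(2) order_less_le_trans)
    show "X (w i) \<omega> = 1" if "i < n" for i
      using A(2) N(2) less[OF that] by (auto simp: is_open_def)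
    show "child r (w i) (w (Suc i))" if "Suc i < n" for i
      using w less[OF that] .
  qed
  then show "\<exists>v\<in>tree_upto r d. reaches r (\<lambda>v. X v \<omega>) n v"
    using A(3) run(1) by auto
next
  assume "\<exists>v\<in>tree_upto r d. reaches r (\<lambda>v. X v \<omega>) n v"
  then obtain w where w0: "w 0 \<in> tree_upto r d"
    and w: "\<And>i. i < n \<Longrightarrow> X (w i) \<omega> = 1" "\<And>i. Suc i < n \<Longrightarrow> child r (w i) (w (Suc i))"
    unfolding reaches_path[OF assms(1)] by auto
  have n: "0 < enat n" using assms(2) by (simp add: zero_enat_def)
  have path: "\<And>i. enat (Suc i) < enat n \<Longrightarrow> child r (w i) (w (Suc i))" using w(2) by simp
  define A where "A = w ` {i. enat i < enat n}"
  have run: "run_root A = w 0" "run_length A = enat n"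
    using child_path_run[of "enat n" r w] path n unfolding A_def by blast+
  have "A \<subseteq> tree r"
    unfolding A_def using child_path_tree[of "enat n" r w] path w0
    by (fastforce simp: tree_upto_def)
  then have "is_run r A"
    unfolding is_run_def using path n A_def by blast
  moreover have "is_open X \<omega> A" using w(1) by (auto simp: is_open_def A_def)
  ultimately show "enat n \<le> longest_run r X d \<omega>"
    unfolding longest_run_def le_Sup_enat_iff[OF assms(2)] using run w0
    by (intro bexI[of _ "run_length A"] CollectI exI[of _ A] conjI) simp_all
qed

definition level :: "nat \<Rightarrow> nat \<Rightarrow> node set" where
  "level r d = {v \<in> tree r. length v = d}"

lemma level_subset_tree: "level r d \<subseteq> tree r"
  by (auto simp: level_def)

lemma finite_level: "finite (level r d)" and card_level: "card (level r d) = r ^ d"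
proof -
  have eq: "level r d = {v. set v \<subseteq> {..<r} \<and> length v = d}"
    by (auto simp: level_def tree_def in_lists_conv_set)
  show "finite (level r d)" unfolding eq by (rule finite_lists_length_eq) simp
  show "card (level r d) = r ^ d" unfolding eq by (subst card_lists_length_eq) auto
qed

lemma finite_tree_upto: "finite (tree_upto r d)"
proof -
  have "tree_upto r d = (\<Union>k\<le>d. level r k)"
    by (auto simp: tree_upto_def level_def gen_def)
  then show ?thesis by (simp add: finite_level)
qed

lemma longest_run_geI:
  assumes "r \<ge> 1" "n > 0" "v \<in> level r d" "reaches r (\<lambda>v. X v \<omega>) n v"
  shows "enat n \<le> longest_run r X d \<omega>"
  unfolding longest_run_ge_iff[OF assms(1,2)] using assms(3,4)
  by (auto simp: tree_upto_def level_def gen_def)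

text \<open>The run is followed down to generation \<open>d\<close>, at the cost of at most
  \<open>d\<close> nodes; \<open>d \<le> n\<close> keeps this descent within the run.\<close>

lemma longest_run_geD:
  assumes "r \<ge> 1" "n > 0" "d \<le> n" "enat n \<le> longest_run r X d \<omega>"
  shows "\<exists>v\<in>level r d. reaches r (\<lambda>v. X v \<omega>) (n - d) v"
proof -
  obtain v where v: "v \<in> tree r" "length v \<le> d" "reaches r (\<lambda>v. X v \<omega>) n v"
    using assms(4) unfolding longest_run_ge_iff[OF assms(1,2)] by (auto simp: tree_upto_def gen_def)
  have "d - length v \<le> n" "length v + (d - length v) = d" using v(2) assms(3) by auto
  then obtain w where w: "w \<in> tree r" "length w = d" "reaches r (\<lambda>v. X v \<omega>) (n - (d - length v)) w"
    using reaches_descendant[OF v(3,1), of "d - length v"] by metis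
  have "reaches r (\<lambda>v. X v \<omega>) (n - d) w"
    by (rule reaches_antimono[OF _ w(3)]) simp
  with w show ?thesis by (auto simp: level_def)
qed

text \<open>An integer is at most a real iff it is at most its floor. The added 1 makes the
  inequality strict and the bound positive, so \<open>n = 0\<close> satisfies both sides;
  \<open>n = \<infinity>\<close> satisfies neither.\<close>

lemma elog_le_iff:
  assumes "b > 1"
  shows "elog b n \<le> ereal y \<longleftrightarrow> n < enat (nat \<lfloor>b powr y\<rfloor> + 1)"
proof (cases n)
  case (enat k)
  have "log b (real k) \<le> y \<longleftrightarrow> k \<le> nat \<lfloor>b powr y\<rfloor>" if "k \<noteq> 0"
  proof -
    have "log b (real k) \<le> y \<longleftrightarrow> real k \<le> b powr y"
      using that assms by (simp add: log_le_iff)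
    also have "\<dots> \<longleftrightarrow> k \<le> nat \<lfloor>b powr y\<rfloor>"
      by (simp add: le_nat_iff le_floor_iff)
    finally show ?thesis .
  qed
  with enat show ?thesis by (auto simp: elog_def)
qed (simp add: elog_def)

subsection \<open>Independence of disjoint subtrees\<close>

definition descendants :: "nat \<Rightarrow> node \<Rightarrow> node set" where
  "descendants r v = (@) v ` tree r"

lemma self_in_descendants: "v \<in> descendants r v"
  by (auto simp: descendants_def tree_def intro!: image_eqI[of _ _ "[]"])

lemma descendants_child_subset: "i < r \<Longrightarrow> descendants r (v @ [i]) \<subseteq> descendants r v"
  by (auto simp: descendants_def tree_def intro!: image_eqI[of _ _ "i # _"])

lemma descendants_subset_tree: "v \<in> tree r \<Longrightarrow> descendants r v \<subseteq> tree r"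
  by (auto simp: descendants_def tree_def)

text \<open>Two prefixes of equal length of the same word coincide.\<close>

lemma descendants_disjoint:
  "length v = length w \<Longrightarrow> v \<noteq> w \<Longrightarrow> descendants r v \<inter> descendants r w = {}"
  by (auto simp: descendants_def)

text \<open>Only states in the subtree at \<open>v\<close> matter; this is what makes events on
  disjoint subtrees independent.\<close>

lemma reaches_cong:
  "(\<And>w. w \<in> descendants r v \<Longrightarrow> f w = g w) \<Longrightarrow> reaches r f n v \<longleftrightarrow> reaches r g n v"
proof (induction n arbitrary: v)
  case (Suc n)
  have "reaches r f n (v @ [i]) \<longleftrightarrow> reaches r g n (v @ [i])" if "i < r" for i
    using Suc.prems descendants_child_subset[OF that, of v] by (intro Suc.IH) blast
  then show ?case using Suc.prems[OF self_in_descendants] by auto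
qed simp

lemma reaches_restrict:
  "reaches r (restrict f (descendants r v)) n v \<longleftrightarrow> reaches r f n v"
  by (rule reaches_cong) simp

text \<open>Stated for arbitrary \<open>N\<close> because it is applied both to \<open>M\<close> and
  to product spaces over subtrees.\<close>

lemma pred_reaches:
  assumes "\<And>w. w \<in> descendants r v \<Longrightarrow> Measurable.pred N (\<lambda>x. f x w = 1)"
  shows "Measurable.pred N (\<lambda>x. reaches r (f x) n v)"
  using assms
proof (induction n arbitrary: v)
  case (Suc n)
  have [measurable]: "Measurable.pred N (\<lambda>x. reaches r (f x) n (v @ [i]))" if "i < r" for i
    using Suc.prems descendants_child_subset[OF that, of v] by (intro Suc.IH) blast
  have [measurable]: "Measurable.pred N (\<lambda>x. f x v = 1)"
    using Suc.prems self_in_descendants by blast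
  have "Measurable.pred N (\<lambda>x. \<exists>i\<in>{..<r}. reaches r (f x) n (v @ [i]))"
    by (rule pred_intros_finite) auto
  then have [measurable]: "Measurable.pred N (\<lambda>x. \<exists>i<r. reaches r (f x) n (v @ [i]))"
    by (simp add: Bex_def)
  show ?case by simp
qed simp

section \<open>Exact probabilities in the critical case: one open child per node on average\<close>

locale critical_tree = prob_space M for M :: "'a measure" +
  fixes X :: "node \<Rightarrow> 'a \<Rightarrow> real" and r :: nat
  assumes indep: "indep_vars (\<lambda>_. borel) X (tree r)"
    and prob_open: "\<And>v. v \<in> tree r \<Longrightarrow> prob {\<omega> \<in> space M. X v \<omega> = 1} = 1 / real r"
    and r_ge_2: "r \<ge> 2"
begin

lemma r_ge_1: "r \<ge> 1"
  using r_ge_2 by simp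

lemma pred_open: "v \<in> tree r \<Longrightarrow> Measurable.pred M (\<lambda>\<omega>. X v \<omega> = 1)"
proof -
  assume "v \<in> tree r"
  then have [measurable]: "X v \<in> borel_measurable M" using indep by (auto simp: indep_vars_def)
  show ?thesis by measurable
qed

lemma pred_reaches_M:
  "v \<in> tree r \<Longrightarrow> Measurable.pred M (\<lambda>\<omega>. reaches r (\<lambda>v. X v \<omega>) n v)"
  using descendants_subset_tree by (intro pred_reaches pred_open) blast

lemma prob_not_reaches:
  assumes "v \<in> tree r"
  shows "prob {\<omega> \<in> space M. \<not> reaches r (\<lambda>v. X v \<omega>) n v} =
    1 - prob {\<omega> \<in> space M. reaches r (\<lambda>v. X v \<omega>) n v}"
  by (rule prob_neg[OF pred_reaches_M[OF assms, unfolded pred_def]])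

lemma prob_Ball_eq_prod:
  assumes "finite L" "L \<noteq> {}"
    and K: "\<And>j. j \<in> L \<Longrightarrow> K j \<subseteq> tree r" "disjoint_family_on K L"
    and P: "\<And>j. j \<in> L \<Longrightarrow> Measurable.pred (PiM (K j) (\<lambda>_. borel)) (P j)"
    and dep: "\<And>j f. j \<in> L \<Longrightarrow> P j (restrict f (K j)) \<longleftrightarrow> P j f"
  shows "prob {\<omega> \<in> space M. \<forall>j\<in>L. P j (\<lambda>v. X v \<omega>)} =
    (\<Prod>j\<in>L. prob {\<omega> \<in> space M. P j (\<lambda>v. X v \<omega>)})"
proof -
  have "indep_vars (\<lambda>_. count_space UNIV) (\<lambda>j \<omega>. P j (restrict (\<lambda>v. X v \<omega>) (K j))) L"
    using indep_vars_restrict[OF indep K] P by (rule indep_vars_compose2)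
  from indep_varsD_finite[OF this assms(2,1), of "\<lambda>_. {True}"]
  have "prob (\<Inter>j\<in>L. (\<lambda>\<omega>. P j (restrict (\<lambda>v. X v \<omega>) (K j))) -` {True} \<inter> space M) =
    (\<Prod>j\<in>L. prob ((\<lambda>\<omega>. P j (restrict (\<lambda>v. X v \<omega>) (K j))) -` {True} \<inter> space M))"
    by simp
  also have "(\<Inter>j\<in>L. (\<lambda>\<omega>. P j (restrict (\<lambda>v. X v \<omega>) (K j))) -` {True} \<inter> space M) =
    {\<omega> \<in> space M. \<forall>j\<in>L. P j (\<lambda>v. X v \<omega>)}"
    using assms(2) dep by auto
  also have "(\<Prod>j\<in>L. prob ((\<lambda>\<omega>. P j (restrict (\<lambda>v. X v \<omega>) (K j))) -` {True} \<inter> space M)) =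
    (\<Prod>j\<in>L. prob {\<omega> \<in> space M. P j (\<lambda>v. X v \<omega>)})"
    by (intro prod.cong refl arg_cong[of _ _ prob]) (auto simp: dep)
  finally show ?thesis .
qed

text \<open>That \<open>v\<close> is open while every child subtree fails is an intersection of
  independent events, of probability \<open>(1 - survival r n)^r / r\<close>. Removing it from the
  event that \<open>v\<close> is open gives the recursion.\<close>

lemma prob_reaches:
  "v \<in> tree r \<Longrightarrow> prob {\<omega> \<in> space M. reaches r (\<lambda>v. X v \<omega>) n v} = survival r n"
proof (induction n arbitrary: v)
  case 0
  then show ?case by (simp add: prob_space)
next
  case (Suc n)
  \<comment> \<open>Index \<open>0\<close> stands for \<open>v\<close> itself, index \<open>Suc i\<close> for the subtree of its \<open>i\<close>-th child.\<close>
  define K where "K = case_nat {v} (\<lambda>i. descendants r (v @ [i]))"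
  define P where "P = case_nat (\<lambda>f. f v = 1) (\<lambda>i f. \<not> reaches r f n (v @ [i]))"
  have child: "v @ [i] \<in> tree r" if "i < r" for i
    using that Suc.prems by (simp add: append_in_tree_iff)
  have "prob {\<omega> \<in> space M. \<forall>j\<in>{..r}. P j (\<lambda>v. X v \<omega>)} =
    (\<Prod>j\<in>{..r}. prob {\<omega> \<in> space M. P j (\<lambda>v. X v \<omega>)})"
  proof (rule prob_Ball_eq_prod)
    show "K j \<subseteq> tree r" if "j \<in> {..r}" for j
      using that Suc.prems descendants_subset_tree[OF child]
      by (auto simp: K_def split: nat.splits)
    have "v \<notin> descendants r (v @ [i])" for i by (auto simp: descendants_def)
    moreover have "descendants r (v @ [i]) \<inter> descendants r (v @ [j]) = {}" if "i \<noteq> j" for i j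
      using that by (intro descendants_disjoint) auto
    ultimately show "disjoint_family_on K {..r}"
      by (auto simp: disjoint_family_on_def K_def split: nat.splits)
    show "Measurable.pred (PiM (K j) (\<lambda>_. borel)) (P j)" if "j \<in> {..r}" for j
    proof (cases j)
      case 0
      then show ?thesis unfolding K_def P_def by simp
    next
      case (Suc i)
      have "Measurable.pred (PiM (descendants r (v @ [i])) (\<lambda>_. borel)) (\<lambda>f. f w = (1::real))"
        if "w \<in> descendants r (v @ [i])" for w
        using that by measurable
      from pred_reaches[OF this] Suc show ?thesis unfolding K_def P_def by simp
    qed
    show "P j (restrict f (K j)) \<longleftrightarrow> P j f" if "j \<in> {..r}" for j f
      by (auto simp: P_def K_def reaches_restrict split: nat.splits)
  qed auto
  also have "\<dots> = prob {\<omega> \<in> space M. X v \<omega> = 1} *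
      (\<Prod>i<r. prob {\<omega> \<in> space M. \<not> reaches r (\<lambda>v. X v \<omega>) n (v @ [i])})"
    unfolding prod.atMost_shift by (simp add: P_def)
  also have "(\<Prod>i<r. prob {\<omega> \<in> space M. \<not> reaches r (\<lambda>v. X v \<omega>) n (v @ [i])}) =
      (\<Prod>i<r. 1 - survival r n)"
  proof (intro prod.cong refl)
    fix i assume "i \<in> {..<r}"
    then have "v @ [i] \<in> tree r" using child by simp
    from prob_not_reaches[OF this, of n] Suc.IH[OF this]
    show "prob {\<omega> \<in> space M. \<not> reaches r (\<lambda>v. X v \<omega>) n (v @ [i])} = 1 - survival r n"
      by simp
  qed
  finally have none: "prob {\<omega> \<in> space M. \<forall>j\<in>{..r}. P j (\<lambda>v. X v \<omega>)} =
      (1 - survival r n) ^ r / real r"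
    by (simp add: prob_open[OF Suc.prems])
  let ?A = "{\<omega> \<in> space M. X v \<omega> = 1}" and ?B = "{\<omega> \<in> space M. \<forall>j\<in>{..r}. P j (\<lambda>v. X v \<omega>)}"
  have B: "?B = {\<omega> \<in> space M. X v \<omega> = 1 \<and> \<not> reaches r (\<lambda>v. X v \<omega>) (Suc n) v}"
    by (auto simp: P_def Suc_le_eq split: nat.splits)
  have sets: "?A \<in> events" "{\<omega> \<in> space M. reaches r (\<lambda>v. X v \<omega>) (Suc n) v} \<in> events"
    using pred_open[OF Suc.prems] pred_reaches_M[OF Suc.prems, of "Suc n"]
    unfolding pred_def by blast+
  let ?R = "{\<omega> \<in> space M. reaches r (\<lambda>v. X v \<omega>) (Suc n) v}"
  have "?B = ?A - ?R" and R: "?R = ?A - ?B" and "?B \<subseteq> ?A"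
    unfolding B by auto
  then have "?B \<in> events" using sets.Diff[OF sets] by simp
  from finite_measure_Diff[OF sets(1) this \<open>?B \<subseteq> ?A\<close>]
  have "prob ?R = prob ?A - prob ?B" unfolding R[symmetric] .
  then show ?case
    by (simp add: none prob_open[OF Suc.prems] diff_divide_distrib)
qed

lemma prob_level_not_reaches:
  "prob {\<omega> \<in> space M. \<forall>v\<in>level r d. \<not> reaches r (\<lambda>v. X v \<omega>) n v} = (1 - survival r n) ^ (r ^ d)"
proof -
  have "level r d \<noteq> {}" using card_level[of r d] r_ge_2 by auto
  then have "prob {\<omega> \<in> space M. \<forall>v\<in>level r d. \<not> reaches r (\<lambda>v. X v \<omega>) n v} =
      (\<Prod>v\<in>level r d. prob {\<omega> \<in> space M. \<not> reaches r (\<lambda>v. X v \<omega>) n v})"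
  proof (intro prob_Ball_eq_prod[of _ "descendants r"] finite_level)
    show "descendants r v \<subseteq> tree r" if "v \<in> level r d" for v
      using that level_subset_tree descendants_subset_tree by blast
    show "disjoint_family_on (descendants r) (level r d)"
      unfolding disjoint_family_on_def by (auto intro!: descendants_disjoint simp: level_def)
    show "Measurable.pred (PiM (descendants r v) (\<lambda>_. borel)) (\<lambda>f. \<not> reaches r f n v)" for v
    proof -
      have "Measurable.pred (PiM (descendants r v) (\<lambda>_. borel)) (\<lambda>f. f w = (1::real))"
        if "w \<in> descendants r v" for w
        using that by measurable
      from pred_reaches[OF this] show ?thesis by simp
    qed
  qed (simp_all only: reaches_restrict not_False_eq_True)
  also have "\<dots> = (\<Prod>v\<in>level r d. 1 - survival r n)"
  proof (intro prod.cong refl)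
    fix v assume "v \<in> level r d"
    then have v: "v \<in> tree r" using level_subset_tree by blast
    show "prob {\<omega> \<in> space M. \<not> reaches r (\<lambda>v. X v \<omega>) n v} = 1 - survival r n"
      using prob_not_reaches[OF v, of n] prob_reaches[OF v] by simp
  qed
  finally show ?thesis by (simp add: card_level)
qed

section \<open>Measurability and two-sided bounds for the law of the longest run\<close>

lemma longest_run_ge_in_events:
  assumes "n > 0"
  shows "{\<omega> \<in> space M. enat n \<le> longest_run r X d \<omega>} \<in> events"
proof -
  have "Measurable.pred M (\<lambda>\<omega>. \<exists>v\<in>tree_upto r d. reaches r (\<lambda>v. X v \<omega>) n v)"
    by (intro pred_intros_finite finite_tree_upto pred_reaches_M) (auto simp: tree_upto_def)
  then show ?thesis
    unfolding longest_run_ge_iff[OF r_ge_1 assms] pred_def .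
qed

lemma longest_run_less_in_events:
  assumes "n > 0"
  shows "{\<omega> \<in> space M. longest_run r X d \<omega> < enat n} \<in> events"
proof -
  have "{\<omega> \<in> space M. longest_run r X d \<omega> < enat n} =
      space M - {\<omega> \<in> space M. enat n \<le> longest_run r X d \<omega>}" by auto
  then show ?thesis using longest_run_ge_in_events[OF assms] by auto
qed

lemma level_not_reaches_in_events:
  "{\<omega> \<in> space M. \<forall>v\<in>level r d. \<not> reaches r (\<lambda>v. X v \<omega>) n v} \<in> events"
proof -
  have "Measurable.pred M (\<lambda>\<omega>. \<forall>v\<in>level r d. \<not> reaches r (\<lambda>v. X v \<omega>) n v)"
    using level_subset_tree
    by (intro pred_intros_finite finite_level pred_intros_logic pred_reaches_M) auto
  then show ?thesis unfolding pred_def .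
qed

lemma prob_longest_run_less_upper:
  assumes "n > 0"
  shows "prob {\<omega> \<in> space M. longest_run r X d \<omega> < enat n} \<le> (1 - survival r n) ^ (r ^ d)"
proof -
  have "{\<omega> \<in> space M. longest_run r X d \<omega> < enat n} \<subseteq>
      {\<omega> \<in> space M. \<forall>v\<in>level r d. \<not> reaches r (\<lambda>v. X v \<omega>) n v}"
  proof safe
    fix \<omega> v
    assume "longest_run r X d \<omega> < enat n" "v \<in> level r d" "reaches r (\<lambda>v. X v \<omega>) n v"
    then show False using longest_run_geI[OF r_ge_1 assms, of v d X \<omega>] by simp
  qed
  from finite_measure_mono[OF this level_not_reaches_in_events] show ?thesis
    unfolding prob_level_not_reaches .
qed

lemma prob_longest_run_less_lower:
  assumes "n > 0" "d \<le> n"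
  shows "(1 - survival r (n - d)) ^ (r ^ d) \<le> prob {\<omega> \<in> space M. longest_run r X d \<omega> < enat n}"
proof -
  have "{\<omega> \<in> space M. \<forall>v\<in>level r d. \<not> reaches r (\<lambda>v. X v \<omega>) (n - d) v} \<subseteq>
      {\<omega> \<in> space M. longest_run r X d \<omega> < enat n}"
  proof safe
    fix \<omega>
    assume "\<forall>v\<in>level r d. \<not> reaches r (\<lambda>v. X v \<omega>) (n - d) v"
    then show "longest_run r X d \<omega> < enat n"
      using longest_run_geD[OF r_ge_1 assms, of X \<omega>] by (metis leI)
  qed
  from finite_measure_mono[OF this longest_run_less_in_events[OF assms(1)]] show ?thesis
    unfolding prob_level_not_reaches .
qed

text \<open>In effect the union bound over generation \<open>d\<close>, obtained from the complement
  by Bernoulli's inequality.\<close>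

lemma prob_longest_run_ge_upper:
  assumes "n > 0" "d \<le> n"
  shows "prob {\<omega> \<in> space M. enat n \<le> longest_run r X d \<omega>} \<le> real (r ^ d) * survival r (n - d)"
proof -
  have "{\<omega> \<in> space M. enat n \<le> longest_run r X d \<omega>} =
      space M - {\<omega> \<in> space M. longest_run r X d \<omega> < enat n}" by auto
  then have "prob {\<omega> \<in> space M. enat n \<le> longest_run r X d \<omega>} =
      1 - prob {\<omega> \<in> space M. longest_run r X d \<omega> < enat n}"
    using prob_compl[OF longest_run_less_in_events[OF assms(1)], of d] by simp
  also have "\<dots> \<le> 1 - (1 - survival r (n - d)) ^ (r ^ d)"
    using prob_longest_run_less_lower[OF assms] by simp
  also have "\<dots> \<le> real (r ^ d) * survival r (n - d)"
    using Bernoulli_inequality[of "- survival r (n - d)" "r ^ d"] survival_le_one[OF r_ge_1, of "n - d"]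
    by simp
  finally show ?thesis .
qed

end

subsection \<open>Limit theorems\<close>

text \<open>The least integer above \<open>r powr y\<close>: by \<open>elog_le_iff\<close>, a
  logarithm of at most \<open>y\<close> means a length below it.\<close>

definition threshold :: "nat \<Rightarrow> real \<Rightarrow> nat" where
  "threshold r y = nat \<lfloor>real r powr y\<rfloor> + 1"

lemma threshold_pos: "threshold r y > 0"
  by (simp add: threshold_def)

lemma threshold_bounds:
  "real r powr y < real (threshold r y)" "real (threshold r y) \<le> real r powr y + 1"
proof -
  have "real (nat \<lfloor>real r powr y\<rfloor>) = of_int \<lfloor>real r powr y\<rfloor>" by simp
  then show "real r powr y < real (threshold r y)" "real (threshold r y) \<le> real r powr y + 1"
    unfolding threshold_def by linarith+
qed

lemma powr_of_nat_add: "b > 0 \<Longrightarrow> b powr (real d + x) = b powr x * b ^ d"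
  by (simp add: powr_add powr_realpow)

lemma threshold_asymptotics:
  assumes "r \<ge> 2"
  shows "(\<lambda>d. real (threshold r (real d + x)) / real r ^ d) \<longlonglongrightarrow> real r powr x"
proof (rule tendsto_sandwich)
  have r: "real r > 0" using assms by simp
  note bounds = threshold_bounds[of r "real d + x" for d, unfolded powr_of_nat_add[OF r]]
  show "\<forall>\<^sub>F d in sequentially. real r powr x \<le> real (threshold r (real d + x)) / real r ^ d"
    using bounds(1) r by (intro always_eventually allI) (simp add: pos_le_divide_eq less_imp_le)
  show "\<forall>\<^sub>F d in sequentially.
      real (threshold r (real d + x)) / real r ^ d \<le> real r powr x + (1 / real r) ^ d"
    using bounds(2) r
    by (intro always_eventually allI) (simp add: pos_divide_le_eq distrib_right power_one_over)
  have "(\<lambda>d. real r powr x + (1 / real r) ^ d) \<longlonglongrightarrow> real r powr x + 0"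
    using assms by (intro tendsto_intros LIMSEQ_power_zero) simp
  then show "(\<lambda>d. real r powr x + (1 / real r) ^ d) \<longlonglongrightarrow> real r powr x" by simp
qed simp

text \<open>Serves both sides of the sandwich, with \<open>k d = d\<close> and with
  \<open>k d = 0\<close>. The first limit is that of \<open>m * survival r m\<close> divided by that
  of \<open>m / r^d\<close>.\<close>

lemma survival_threshold_asymptotics:
  fixes r :: nat and k :: "nat \<Rightarrow> nat" and x :: real
  assumes "r \<ge> 2" and k: "(\<lambda>d. real (k d) / real r ^ d) \<longlonglongrightarrow> 0"
  defines "m \<equiv> \<lambda>d. threshold r (real d + x) - k d"
  shows "(\<lambda>d. real (r ^ d) * survival r (m d)) \<longlonglongrightarrow> 2 / (real r - 1) * real r powr (- x)"
    and "(\<lambda>d. survival r (m d)) \<longlonglongrightarrow> 0" and "\<forall>\<^sub>F d in sequentially. m d > 0"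
proof -
  have r: "real r > 1" using assms by simp
  \<comment> \<open>Subtraction on \<open>nat\<close> stops at 0, hence \<open>max 0\<close>; it
    disappears in the limit since \<open>r powr x > 0\<close>.\<close>
  have m_eq: "real (m d) / real r ^ d =
      max 0 (real (threshold r (real d + x)) / real r ^ d - real (k d) / real r ^ d)" for d
    using r unfolding m_def diff_divide_distrib[symmetric]
    by (cases "k d \<le> threshold r (real d + x)") (auto simp: max_def field_simps of_nat_diff)
  have "(\<lambda>d. real (m d) / real r ^ d) \<longlonglongrightarrow> max 0 (real r powr x - 0)"
    unfolding m_eq by (intro tendsto_intros tendsto_max threshold_asymptotics k assms)
  then have ratio: "(\<lambda>d. real (m d) / real r ^ d) \<longlonglongrightarrow> real r powr x" by simp
  have pos: "real r powr x > 0" using r by simp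
  have "\<forall>\<^sub>F d in sequentially. real (m d) / real r ^ d > 0"
    using order_tendstoD(1)[OF ratio pos] .
  then show m_pos: "\<forall>\<^sub>F d in sequentially. m d > 0"
    by eventually_elim (auto simp: zero_less_divide_iff)
  have "filterlim (\<lambda>d. real r ^ d) at_top sequentially"
  proof (rule filterlim_at_top_mono[OF filterlim_real_sequentially])
    have "real d \<le> real r ^ d" for d
      using power_gt_expt[of r d] assms(1) by (metis Suc_le_lessD numeral_2_eq_2 of_nat_le_iff of_nat_power less_imp_le)
    then show "\<forall>\<^sub>F d in sequentially. real d \<le> real r ^ d" by simp
  qed
  from filterlim_tendsto_pos_mult_at_top[OF ratio pos this]
  have "filterlim (\<lambda>d. real (m d)) at_top sequentially"
    using r by simp
  then have m_top: "filterlim m at_top sequentially"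
    by (simp add: filterlim_sequentially_iff_filterlim_real)
  show "(\<lambda>d. survival r (m d)) \<longlonglongrightarrow> 0"
    by (rule filterlim_compose[OF survival_tendsto_0[OF assms(1)] m_top])
  have "(\<lambda>d. real (m d) * survival r (m d)) \<longlonglongrightarrow> 2 / (real r - 1)"
    by (rule filterlim_compose[OF survival_asymptotics[OF assms(1)] m_top])
  from tendsto_divide[OF this ratio]
  have "(\<lambda>d. real (m d) * survival r (m d) / (real (m d) / real r ^ d))
      \<longlonglongrightarrow> 2 / (real r - 1) * real r powr (- x)"
    using pos by (simp add: powr_minus_divide)
  then show "(\<lambda>d. real (r ^ d) * survival r (m d)) \<longlonglongrightarrow> 2 / (real r - 1) * real r powr (- x)"
  proof (rule Lim_transform_eventually)
    show "\<forall>\<^sub>F d in sequentially. real (m d) * survival r (m d) / (real (m d) / real r ^ d) =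
        real (r ^ d) * survival r (m d)"
      using m_pos by eventually_elim simp
  qed
qed

text \<open>Ensures that thresholds of order \<open>r^((1 + e) d)\<close> exceed \<open>2 d\<close>,
  so that losing \<open>d\<close> nodes costs at most half of them.\<close>

lemma double_le_power:
  assumes "r \<ge> 2" "d \<ge> 1"
  shows "2 * d \<le> r ^ d"
  using assms(2)
proof (induction d rule: dec_induct)
  case (step d)
  have "2 * Suc d \<le> 2 * (2 * d)" using step by simp
  also have "\<dots> \<le> r * r ^ d" using step assms by (intro mult_mono) auto
  finally show ?case by simp
qed (use assms in simp)

text \<open>Countably many margins \<open>1 / Suc k\<close> suffice, so the exceptional null sets
  can later be united.\<close>

lemma ereal_divide_tendsto_1:
  fixes f :: "nat \<Rightarrow> ereal"
  assumes lower: "\<And>k. \<forall>\<^sub>F d in sequentially. ereal ((1 - 1 / real (Suc k)) * real d) < f d"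
    and upper: "\<And>k. \<forall>\<^sub>F d in sequentially. f d \<le> ereal ((1 + 1 / real (Suc k)) * real d)"
  shows "(\<lambda>d. f d / ereal (real d)) \<longlonglongrightarrow> 1"
proof -
  define z where "z d = real_of_ereal (f d)" for d
  \<comment> \<open>Both bounds for \<open>k = 0\<close> are finite, which rules out infinite values
    of \<open>f d\<close>.\<close>
  have fz: "\<forall>\<^sub>F d in sequentially. f d = ereal (z d)"
    using lower[of 0] upper[of 0]
  proof eventually_elim
    case (elim d)
    then show ?case unfolding z_def by (cases "f d") auto
  qed
  have "(\<lambda>d. z d / real d) \<longlonglongrightarrow> 1"
  proof (rule tendstoI)
    fix e :: real assume "0 < e"
    then obtain k where k: "1 / real (Suc k) < e"
      using nat_approx_posE by blast
    show "\<forall>\<^sub>F d in sequentially. dist (z d / real d) 1 < e"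
      using lower[of k] upper[of k] fz eventually_gt_at_top[of 0]
    proof eventually_elim
      case (elim d)
      then have "1 - 1 / real (Suc k) < z d / real d" "z d / real d \<le> 1 + 1 / real (Suc k)"
        by (auto simp: pos_less_divide_eq pos_divide_le_eq)
      with k show ?case by (simp add: dist_real_def abs_less_iff del: of_nat_Suc)
    qed
  qed
  then have "(\<lambda>d. ereal (z d / real d)) \<longlonglongrightarrow> 1"
    unfolding one_ereal_def by (intro tendsto_ereal)
  then show ?thesis
  proof (rule Lim_transform_eventually)
    show "\<forall>\<^sub>F d in sequentially. ereal (z d / real d) = f d / ereal (real d)"
      using fz eventually_gt_at_top[of 0] by eventually_elim simp
  qed
qed

section \<open>The limit law and the almost sure growth rate\<close>

context critical_tree
begin

lemma elog_longest_run_le_iff: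
  "elog (real r) (longest_run r X d \<omega>) \<le> ereal y \<longleftrightarrow> longest_run r X d \<omega> < enat (threshold r y)"
  unfolding threshold_def using elog_le_iff[of "real r"] r_ge_2 by simp

lemma longest_run_limit_law:
  "(\<lambda>d. prob {\<omega> \<in> space M. elog (real r) (longest_run r X d \<omega>) \<le> ereal (real d + x)})
    \<longlonglongrightarrow> exp (- (2 / (real r - 1) * real r powr (- x)))"
  unfolding elog_longest_run_le_iff
proof (rule tendsto_sandwich)
  let ?n = "\<lambda>d. threshold r (real d + x)"
  have k: "(\<lambda>d. real d / real r ^ d) \<longlonglongrightarrow> 0"
  proof -
    have "(\<lambda>d. real d * (1 / real r) ^ d) \<longlonglongrightarrow> 0"
      using r_ge_2 by (intro powser_times_n_limit_0) simp
    then show ?thesis by (simp add: power_one_over)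
  qed
  \<comment> \<open>The shift by \<open>d\<close> belongs to the lower bound; its third part,
    positivity of the shifted length, supplies \<open>d \<le> ?n d\<close> eventually.\<close>
  note shifted = survival_threshold_asymptotics[OF r_ge_2 k, of x]
  note unshifted = survival_threshold_asymptotics[OF r_ge_2, of "\<lambda>_. 0" x, simplified]
  show "\<forall>\<^sub>F d in sequentially. (1 - survival r (?n d - d)) ^ (r ^ d) \<le>
      prob {\<omega> \<in> space M. longest_run r X d \<omega> < enat (?n d)}"
    using shifted(3) by eventually_elim (rule prob_longest_run_less_lower, auto)
  show "\<forall>\<^sub>F d in sequentially. prob {\<omega> \<in> space M. longest_run r X d \<omega> < enat (?n d)} \<le>
      (1 - survival r (?n d)) ^ (r ^ d)"
    by (intro always_eventually allI prob_longest_run_less_upper threshold_pos)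
  show "(\<lambda>d. (1 - survival r (?n d - d)) ^ (r ^ d))
      \<longlonglongrightarrow> exp (- (2 / (real r - 1) * real r powr (- x)))"
    using survival_pos[OF r_ge_1] shifted
    by (intro tendsto_one_minus_power_exp) (auto intro: less_imp_le)
  show "(\<lambda>d. (1 - survival r (?n d)) ^ (r ^ d))
      \<longlonglongrightarrow> exp (- (2 / (real r - 1) * real r powr (- x)))"
    using survival_pos[OF r_ge_1] unshifted
    by (intro tendsto_one_minus_power_exp) (auto intro: less_imp_le)
qed

text \<open>With \<open>b = r powr e\<close> the threshold exceeds \<open>r^d b^d\<close>. The union
  bound has \<open>r^d\<close> terms of order \<open>1 / (r^d b^d)\<close>, which leaves a summable
  multiple of \<open>b^(-d)\<close>.\<close>

lemma AE_elog_longest_run_upper: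
  assumes "e > 0"
  shows "AE \<omega> in M. \<forall>\<^sub>F d in sequentially.
    elog (real r) (longest_run r X d \<omega>) \<le> ereal ((1 + e) * real d)"
proof -
  let ?n = "\<lambda>d. threshold r ((1 + e) * real d)"
  define A where "A d = {\<omega> \<in> space M. enat (?n d) \<le> longest_run r X d \<omega>}" for d
  have A: "A d \<in> events" for d
    unfolding A_def by (intro longest_run_ge_in_events threshold_pos)
  have bound: "prob (A d) \<le> 2 * real r * (real r powr - e) ^ d" if d: "d \<ge> 1" for d
  proof -
    define b where "b = real r powr e"
    have b: "b > 1" unfolding b_def using assms r_ge_2 by simp
    have r: "real r > 1" using r_ge_2 by simp
    have y: "real r powr ((1 + e) * real d) = real r ^ d * b ^ d"
      using r unfolding b_def
      by (simp add: distrib_right powr_add powr_realpow powr_powr[symmetric])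
    have "2 * real d \<le> real r ^ d"
      using double_le_power[OF r_ge_2 d] by (metis of_nat_le_iff of_nat_mult of_nat_numeral of_nat_power)
    also have "\<dots> * 1 \<le> real r ^ d * b ^ d"
      using b r by (intro mult_left_mono one_le_power) auto
    finally have "2 * real d \<le> real r ^ d * b ^ d" by simp
    moreover have n: "real r ^ d * b ^ d < real (?n d)"
      using threshold_bounds(1)[of r "(1 + e) * real d"] y by simp
    \<comment> \<open>Hence at least half of the threshold remains after the shift; this is the
      factor 2 in the bound.\<close>
    ultimately have "2 * d < ?n d" by linarith
    then have le: "real r ^ d * b ^ d / 2 \<le> real (?n d - d)"
      using n by (simp add: of_nat_diff)
    have rb: "real r ^ d * b ^ d > 0" using b r by simp
    have "prob (A d) \<le> real (r ^ d) * survival r (?n d - d)"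
      unfolding A_def using \<open>2 * d < ?n d\<close>
      by (intro prob_longest_run_ge_upper threshold_pos) simp
    also have "\<dots> \<le> real r ^ d * (real r / real (?n d - d))"
    proof -
      have "survival r (?n d - d) \<le> real r / real (?n d - d)"
        using \<open>2 * d < ?n d\<close> by (intro survival_upper_bound r_ge_2) simp
      then show ?thesis unfolding of_nat_power by (rule mult_left_mono) simp
    qed
    also have "\<dots> \<le> real r ^ d * (real r / (real r ^ d * b ^ d / 2))"
      using le rb r by (intro mult_left_mono divide_left_mono mult_pos_pos) auto
    also have "\<dots> = 2 * real r * (real r powr - e) ^ d"
      using r b by (simp add: powr_minus b_def[symmetric] power_inverse field_simps)
    finally show ?thesis .
  qed
  have "summable (\<lambda>d. 2 * real r * (real r powr - e) ^ d)"
    using assms r_ge_2 by (intro summable_mult summable_geometric) (simp add: powr_less_one)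
  then have "summable (\<lambda>d. prob (A d))"
    by (rule summable_comparison_test'[where N = 1]) (use bound in simp)
  from borel_cantelli_AE1[OF A _ this]
  have "AE \<omega> in M. \<forall>\<^sub>F d in sequentially. \<omega> \<in> space M - A d"
    by (simp add: less_top[symmetric])
  then show ?thesis
  proof eventually_elim
    case (elim \<omega>)
    then show ?case
      by eventually_elim (auto simp: A_def elog_longest_run_le_iff not_le)
  qed
qed

text \<open>Here \<open>r^d * survival r n\<close> grows at least geometrically, so even the weak
  inequality \<open>exp (- t) \<le> 1 / t\<close> bounds the probability by a summable
  sequence.\<close>

lemma AE_elog_longest_run_lower:
  assumes "e > 0" "e \<le> 1"
  shows "AE \<omega> in M. \<forall>\<^sub>F d in sequentially.
    ereal ((1 - e) * real d) < elog (real r) (longest_run r X d \<omega>)"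
proof -
  let ?n = "\<lambda>d. threshold r ((1 - e) * real d)"
  define A where "A d = {\<omega> \<in> space M. longest_run r X d \<omega> < enat (?n d)}" for d
  have A: "A d \<in> events" for d
    unfolding A_def by (intro longest_run_less_in_events threshold_pos)
  \<comment> \<open>\<open>1 + r^2\<close> comes from \<open>survival_lower_bound\<close>, the 2
    from rounding in the threshold.\<close>
  define K where "K = 2 * (1 + real r * real r)"
  have bound: "prob (A d) \<le> K * (real r powr - e) ^ d" for d
  proof -
    define b where "b = real r powr - e"
    let ?q = "survival r (?n d)"
    have r: "real r > 1" using r_ge_2 by simp
    have q: "0 < ?q" "?q \<le> 1" using survival_pos_le_one[OF r_ge_1] by auto
    have y: "real r powr ((1 - e) * real d) = real r ^ d * b ^ d"
      using r unfolding b_def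
      by (simp add: left_diff_distrib powr_diff powr_realpow powr_powr[symmetric] powr_minus
          power_inverse field_simps)
    \<comment> \<open>Because \<open>e \<le> 1\<close> the power is at least 1, so the added 1 in
      the threshold costs at most a factor 2.\<close>
    have "1 \<le> real r powr ((1 - e) * real d)"
      using assms r by (intro ge_one_powr_ge_zero) auto
    then have n: "real (?n d) \<le> 2 * (real r ^ d * b ^ d)"
      using threshold_bounds(2)[of r "(1 - e) * real d"] y by simp
    have n_pos: "0 < real (?n d)" using threshold_pos by simp
    have qn: "1 / ?q \<le> (1 + real r * real r) * real (?n d)"
      using survival_lower_bound[OF r_ge_2, of "?n d"] threshold_pos[of r "(1 - e) * real d"] q
        n_pos le_imp_inverse_le[of "1 / ((1 + real r * real r) * real (?n d))" ?q]
      by (simp add: inverse_eq_divide Suc_le_eq add_pos_nonneg)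
    have "prob (A d) \<le> (1 - ?q) ^ (r ^ d)"
      unfolding A_def by (intro prob_longest_run_less_upper threshold_pos)
    also have "\<dots> \<le> exp (- ?q) ^ (r ^ d)"
      using exp_ge_add_one_self[of "- ?q"] q by (intro power_mono) auto
    also have "\<dots> = 1 / exp (real r ^ d * ?q)"
      by (simp add: exp_of_nat_mult[of "r ^ d", simplified] exp_minus power_inverse inverse_eq_divide[symmetric])
    also have "\<dots> \<le> 1 / (real r ^ d * ?q)"
    proof (rule divide_left_mono)
      show "real r ^ d * ?q \<le> exp (real r ^ d * ?q)"
        using exp_ge_add_one_self[of "real r ^ d * ?q"] by linarith
    qed (use q r in auto)
    also have "\<dots> = 1 / ?q / real r ^ d" by simp
    also have "\<dots> \<le> (1 + real r * real r) * (2 * (real r ^ d * b ^ d)) / real r ^ d"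
      using qn n r by (intro divide_right_mono order_trans[OF qn] mult_left_mono) auto
    also have "\<dots> = K * b ^ d" using r by (simp add: K_def)
    finally show ?thesis unfolding b_def .
  qed
  have "summable (\<lambda>d. K * (real r powr - e) ^ d)"
    using assms r_ge_2 by (intro summable_mult summable_geometric) (simp add: powr_less_one)
  then have "summable (\<lambda>d. prob (A d))"
    by (rule summable_comparison_test'[where N = 0]) (use bound in simp)
  from borel_cantelli_AE1[OF A _ this]
  have "AE \<omega> in M. \<forall>\<^sub>F d in sequentially. \<omega> \<in> space M - A d"
    by (simp add: less_top[symmetric])
  then show ?thesis
  proof eventually_elim
    case (elim \<omega>)
    then show ?case
      by eventually_elim (auto simp: A_def elog_longest_run_le_iff[symmetric])
  qed
qed

text \<open>Intersects countably many almost sure events; the margin 1 at \<open>k = 0\<close> is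
  still admissible in the lower bound.\<close>

lemma AE_elog_longest_run_tendsto:
  "AE \<omega> in M. (\<lambda>d. elog (real r) (longest_run r X d \<omega>) / ereal (real d)) \<longlonglongrightarrow> 1"
proof -
  have "AE \<omega> in M. \<forall>k. \<forall>\<^sub>F d in sequentially.
      ereal ((1 - 1 / real (Suc k)) * real d) < elog (real r) (longest_run r X d \<omega>)"
    unfolding AE_all_countable by (intro allI AE_elog_longest_run_lower) auto
  moreover have "AE \<omega> in M. \<forall>k. \<forall>\<^sub>F d in sequentially.
      elog (real r) (longest_run r X d \<omega>) \<le> ereal ((1 + 1 / real (Suc k)) * real d)"
    unfolding AE_all_countable by (intro allI AE_elog_longest_run_upper) auto
  ultimately show ?thesis
    by eventually_elim (intro ereal_divide_tendsto_1; blast)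
qed

end

theorem theorem3:
  fixes M :: "'a measure" and X :: "node \<Rightarrow> 'a \<Rightarrow> real" and r :: nat and p C :: real
  assumes "prob_space M"
    and "prob_space.indep_vars M (\<lambda>_. borel) X (tree r)"
    and "\<And>v. v \<in> tree r \<Longrightarrow> measure M {\<omega> \<in> space M. X v \<omega> = 1} = p"
    and "\<And>v. v \<in> tree r \<Longrightarrow> measure M {\<omega> \<in> space M. X v \<omega> = 0} = 1 - p"
    and "0 < p" and "p < 1"
    and "2 \<le> r" and "p = 1 / real r"
    and "C = 2 * real r * p / (real r - 1)"
  shows "(AE \<omega> in M.
            (\<lambda>d. elog (real r) (longest_run r X d \<omega>) / ereal (real d)) \<longlonglongrightarrow> 1) \<and>
         (\<forall>x::real.
            (\<lambda>d. measure M {\<omega> \<in> space M.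
                   elog (real r) (longest_run r X d \<omega>) \<le> ereal (real d + x)})
              \<longlonglongrightarrow> exp (- C * real r powr (- x)))"
proof -
  interpret critical_tree M X r
    using assms by (intro critical_tree.intro critical_tree_axioms.intro) auto
  have "C = 2 / (real r - 1)" using assms by simp
  then show ?thesis
    using AE_elog_longest_run_tendsto longest_run_limit_law by simp
qed

end
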